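(* Let $1<\alpha<2$, $K_\alpha>0$, $L,T>0$. The difference scheme $$\mathcal{L}\delta_t u_j^{k+\frac12}=-\mathcal{L}u_j^{k+\frac12}+K_\alpha\delta_x^\alpha u_j^{k+\frac12}+\mathcal{L}f_j^{k+\frac12},\quad 0\le k\le N-1,\ 1\le j\le M-1,$$ $$u_j^0=u^0(x_j),\ 0\le j\le M,\qquad u_0^k=u_M^k=0,\ 1\le k\le N,$$ is unconditionally stable with respect to the initial values. That is, there is a constant $C>0$ independent of $\tau$, $h$ and $k$ such that for all positive integers $M,N$, if $\{u_j^k\}$ solves this scheme and $\{v_j^k\}$ solves the same scheme with the initial values replaced by $v_j^0=u^0(x_j)+\varepsilon_j$, where $\boldsymbol{\varepsilon}\in\mathcal{V}_h$, then $\|\boldsymbol{u}^k-\boldsymbol{v}^k\|\le C\|\boldsymbol{\varepsilon}\|$ for all $0\le k\le N$.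
   Context: Grid: $\tau=T/N$, $h=L/M$, $t_k=k\tau$, $x_j=jh$. The functions $f$ on $[0,L]\times[0,T]$ and $u^0$ on $[0,L]$ are given and suitably smooth, and $f_j^{k+\frac12}$ is the value of $f$ at $(x_j,t_{k+\frac12})$, with $t_{k+\frac12}=(k+\frac12)\tau$. Notation: $\delta_tu_j^{k+\frac12}=\frac{u_j^{k+1}-u_j^k}{\tau}$, $u_j^{k+\frac12}=\frac{u_j^{k+1}+u_j^k}{2}$. $\mathcal{L}w_j=w_j+\sigma_2^{(\alpha)}(w_{j+1}-2w_j+w_{j-1})$ with $\sigma_2^{(\alpha)}=-\frac{2\alpha^2-6\alpha+3}{6\alpha}$. $$\delta_x^\alpha w_j=-\frac{1}{2\cos(\frac{\pi\alpha}{2})h^\alpha}\left(\sum_{\ell=0}^{j+1}\kappa_{2,\ell}^{(\alpha)}w_{j-\ell+1}+\sum_{\ell=0}^{M-j+1}\kappa_{2,\ell}^{(\alpha)}w_{j+\ell-1}\right),$$ with $\left(\frac{3\alpha-2}{2\alpha}-\frac{2(\alpha-1)}{\alpha}z+\frac{\alpha-2}{2\alpha}z^2\right)^{\alpha}=\sum_{\ell=0}^{\infty}\kappa_{2,\ell}^{(\alpha)}z^\ell$, $|z|<1$. $\mathcal{V}_h=\{\boldsymbol v=(v_0,\ldots,v_M): v_0=v_M=0\}$ with $(\boldsymbol u,\boldsymbol v)=h\sum_{j=1}^{M-1}u_jv_j$ and $\|\boldsymbol u\|^2=(\boldsymbol u,\boldsymbol u)$. *)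

theory Defs
  imports "HOL-Analysis.Analysis"
begin

definition W2 :: "real \<Rightarrow> complex \<Rightarrow> complex" where
  "W2 \<alpha> z = of_real ((3 * \<alpha> - 2) / (2 * \<alpha>)) - of_real (2 * (\<alpha> - 1) / \<alpha>) * z
             + of_real ((\<alpha> - 2) / (2 * \<alpha>)) * z\<^sup>2"

text \<open>The power is the principal branch. For \<open>1 < \<alpha> < 2\<close> exactly one real sequence has this
  generating function: see \<open>ex1_kappa2\<close> below.\<close>

definition kappa2 :: "real \<Rightarrow> nat \<Rightarrow> real" where
  "kappa2 \<alpha> = (THE c. \<forall>z::complex. norm z < 1 \<longrightarrow>
      (\<lambda>l. of_real (c l) * z ^ l) sums (W2 \<alpha> z powr of_real \<alpha>))"

definition sigma2 :: "real \<Rightarrow> real" where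
  "sigma2 \<alpha> = - (2 * \<alpha>\<^sup>2 - 6 * \<alpha> + 3) / (6 * \<alpha>)"

text \<open>A grid vector \<open>(w\<^sub>0, \<dots>, w\<^sub>M)\<close> is a function \<open>w :: nat \<Rightarrow> real\<close> of which only the values at
  indices \<open>\<le> M\<close> are used. The two spatial operators are meant for \<open>1 \<le> j \<le> M - 1\<close>.\<close>

definition Lop :: "real \<Rightarrow> (nat \<Rightarrow> real) \<Rightarrow> nat \<Rightarrow> real" where
  "Lop \<alpha> w j = w j + sigma2 \<alpha> * (w (j + 1) - 2 * w j + w (j - 1))"

text \<open>The index \<open>j - l + 1\<close> is written \<open>j + 1 - l\<close>, so that the subtraction of natural numbers is
  not truncated at \<open>l = j + 1\<close>.\<close>

definition delta_x :: "real \<Rightarrow> real \<Rightarrow> nat \<Rightarrow> (nat \<Rightarrow> real) \<Rightarrow> nat \<Rightarrow> real" where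
  "delta_x \<alpha> h M w j = - (1 / (2 * cos (pi * \<alpha> / 2) * h powr \<alpha>)) *
      ((\<Sum>l = 0..j + 1. kappa2 \<alpha> l * w (j + 1 - l))
       + (\<Sum>l = 0..M - j + 1. kappa2 \<alpha> l * w (j + l - 1)))"

text \<open>A grid function \<open>u\<close> has the value \<open>u k j\<close> at time level \<open>k\<close> and spatial node \<open>j\<close>; the next
  two functions take the value at \<open>k\<close> as the value at time level \<open>k + 1/2\<close>.\<close>

definition delta_t :: "real \<Rightarrow> (nat \<Rightarrow> nat \<Rightarrow> real) \<Rightarrow> nat \<Rightarrow> nat \<Rightarrow> real" where
  "delta_t \<tau> u k j = (u (k + 1) j - u k j) / \<tau>"

definition mid_t :: "(nat \<Rightarrow> nat \<Rightarrow> real) \<Rightarrow> nat \<Rightarrow> nat \<Rightarrow> real" where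
  "mid_t u k j = (u (k + 1) j + u k j) / 2"

definition solves_scheme ::
  "real \<Rightarrow> real \<Rightarrow> real \<Rightarrow> real \<Rightarrow> (real \<Rightarrow> real \<Rightarrow> real) \<Rightarrow> nat \<Rightarrow> nat \<Rightarrow> (nat \<Rightarrow> real)
    \<Rightarrow> (nat \<Rightarrow> nat \<Rightarrow> real) \<Rightarrow> bool" where
  "solves_scheme \<alpha> K L T f M N init u \<longleftrightarrow>
     (let h = L / real M; \<tau> = T / real N in
       (\<forall>k j. k \<le> N - 1 \<longrightarrow> 1 \<le> j \<longrightarrow> j \<le> M - 1 \<longrightarrow>
          Lop \<alpha> (delta_t \<tau> u k) j
            = - Lop \<alpha> (mid_t u k) j + K * delta_x \<alpha> h M (mid_t u k) j
              + Lop \<alpha> (\<lambda>i. f (real i * h) ((real k + 1 / 2) * \<tau>)) j)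
     \<and> (\<forall>j \<le> M. u 0 j = init j)
     \<and> (\<forall>k. 1 \<le> k \<longrightarrow> k \<le> N \<longrightarrow> u k 0 = 0 \<and> u k M = 0))"

definition V_h :: "nat \<Rightarrow> (nat \<Rightarrow> real) set" where
  "V_h M = {v. v 0 = 0 \<and> v M = 0}"

definition inner_h :: "real \<Rightarrow> nat \<Rightarrow> (nat \<Rightarrow> real) \<Rightarrow> (nat \<Rightarrow> real) \<Rightarrow> real" where
  "inner_h h M u v = h * (\<Sum>j = 1..M - 1. u j * v j)"

definition norm_h :: "real \<Rightarrow> nat \<Rightarrow> (nat \<Rightarrow> real) \<Rightarrow> real" where
  "norm_h h M u = sqrt (inner_h h M u u)"

lemma powr_mult_Re_pos:
  fixes w z s :: complex
  assumes "Re w > 0" "Re z > 0"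
  shows "(w * z) powr s = w powr s * z powr s"
proof -
  have nz: "w \<noteq> 0" "z \<noteq> 0" using assms by auto
  have "\<bar>Im (Ln w)\<bar> < pi / 2" "\<bar>Im (Ln z)\<bar> < pi / 2"
    using assms nz Re_Ln_pos_lt by blast+
  then have "Ln (w * z) = Ln w + Ln z"
    using nz by (intro Ln_times_simple) auto
  then show ?thesis using nz by (simp add: powr_def exp_add algebra_simps)
qed

lemma W2_factor:
  assumes "1 < \<alpha>" "\<alpha> < 2"
  shows "W2 \<alpha> z = of_real ((3 * \<alpha> - 2) / (2 * \<alpha>))
           * ((1 + (- z)) * (1 + of_real ((2 - \<alpha>) / (3 * \<alpha> - 2)) * z))"
proof -
  define a r where "a = (3 * \<alpha> - 2) / (2 * \<alpha>)" and "r = (2 - \<alpha>) / (3 * \<alpha> - 2)"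
  have 1: "2 * (\<alpha> - 1) / \<alpha> = a * (1 - r)" and 2: "(\<alpha> - 2) / (2 * \<alpha>) = - (a * r)"
    using assms unfolding a_def r_def by (auto simp: field_simps)
  show ?thesis
    unfolding W2_def 1 2 a_def[symmetric] r_def[symmetric]
    by (simp add: algebra_simps power2_eq_square)
qed

lemma ex1_kappa2:
  assumes "1 < \<alpha>" "\<alpha> < 2"
  shows "\<exists>!c :: nat \<Rightarrow> real. \<forall>z::complex. norm z < 1 \<longrightarrow>
      (\<lambda>l. of_real (c l) * z ^ l) sums (W2 \<alpha> z powr of_real \<alpha>)"
proof (rule ex_ex1I)
  define a r where "a = (3 * \<alpha> - 2) / (2 * \<alpha>)" and "r = (2 - \<alpha>) / (3 * \<alpha> - 2)"
  have a: "a > 0" and r: "0 < r" "r < 1"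
    using assms by (auto simp: a_def r_def divide_simps)
  define c where "c n = a powr \<alpha> *
     (\<Sum>i\<le>n. ((\<alpha> gchoose i) * (-1) ^ i) * ((\<alpha> gchoose (n - i)) * r ^ (n - i)))" for n
  have gb: "(of_real \<alpha> :: complex) gchoose n = of_real (\<alpha> gchoose n)" for n
    by (simp add: gbinomial_prod_rev)
  have bin: "(\<lambda>n. of_real (\<alpha> gchoose n) * x ^ n) sums (1 + x) powr of_real \<alpha>"
    and bins: "summable (\<lambda>n. norm (of_real (\<alpha> gchoose n) * x ^ n))"
    if "norm x < 1" for x :: complex
  proof -
    show "(\<lambda>n. of_real (\<alpha> gchoose n) * x ^ n) sums (1 + x) powr of_real \<alpha>"
      using gen_binomial_complex[OF that, of "of_real \<alpha>"] by (simp add: gb)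
    have "ereal (norm x) < conv_radius (\<lambda>n. (of_real \<alpha> :: complex) gchoose n)"
      using that by (auto simp: conv_radius_gchoose)
    from abs_summable_in_conv_radius[OF this]
    show "summable (\<lambda>n. norm (of_real (\<alpha> gchoose n) * x ^ n))" by (simp add: gb)
  qed
  have "(\<lambda>l. of_real (c l) * z ^ l) sums (W2 \<alpha> z powr of_real \<alpha>)"
    if z: "norm z < 1" for z :: complex
  proof -
    have nrz: "norm (of_real r * z) < 1"
      using z r by (simp add: norm_mult) (smt (verit) mult_left_le_one_le norm_ge_zero)
    have nz: "norm (- z) < 1" using z by simp
    have pos: "Re (1 + x) > 0" if "norm x < 1" for x :: complex
      using abs_Re_le_cmod[of x] that by simp
    have eq: "W2 \<alpha> z powr of_real \<alpha> = of_real (a powr \<alpha>) *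
        ((1 + (- z)) powr of_real \<alpha> * (1 + of_real r * z) powr of_real \<alpha>)"
      unfolding W2_factor[OF assms] a_def[symmetric] r_def[symmetric]
      using a powr_mult_Re_pos[OF pos[OF nz] pos[OF nrz], of "of_real \<alpha>"]
      by (subst powr_times_real_left) (simp_all add: powr_of_real)
    have "(\<lambda>k. \<Sum>i\<le>k. (of_real (\<alpha> gchoose i) * (- z) ^ i)
             * (of_real (\<alpha> gchoose (k - i)) * (of_real r * z) ^ (k - i)))
          sums ((1 + (- z)) powr of_real \<alpha> * (1 + of_real r * z) powr of_real \<alpha>)"
      using Cauchy_product_sums[OF bins[OF nz] bins[OF nrz]]
      by (simp only: sums_unique[OF bin[OF nz], symmetric] sums_unique[OF bin[OF nrz], symmetric])
    then have "(\<lambda>k. of_real (a powr \<alpha>) * (\<Sum>i\<le>k. (of_real (\<alpha> gchoose i) * (- z) ^ i)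
             * (of_real (\<alpha> gchoose (k - i)) * (of_real r * z) ^ (k - i))))
          sums (W2 \<alpha> z powr of_real \<alpha>)"
      unfolding eq by (rule sums_mult)
    moreover have "of_real (a powr \<alpha>) * (\<Sum>i\<le>k. (of_real (\<alpha> gchoose i) * (- z) ^ i)
             * (of_real (\<alpha> gchoose (k - i)) * (of_real r * z) ^ (k - i)))
          = of_real (c k) * z ^ k" for k
    proof -
      have "(of_real (\<alpha> gchoose i) * (- z) ^ i)
             * (of_real (\<alpha> gchoose (k - i)) * (of_real r * z) ^ (k - i))
          = of_real (((\<alpha> gchoose i) * (-1) ^ i) * ((\<alpha> gchoose (k - i)) * r ^ (k - i))) * z ^ k"
        if "i \<le> k" for i
      proof -
        have "(- z) ^ i = (-1) ^ i * z ^ i" by (rule power_minus)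
        moreover have "z ^ k = z ^ i * z ^ (k - i)"
          using that by (simp add: power_add[symmetric])
        ultimately show ?thesis by (simp add: power_mult_distrib)
      qed
      then have "(\<Sum>i\<le>k. (of_real (\<alpha> gchoose i) * (- z) ^ i)
             * (of_real (\<alpha> gchoose (k - i)) * (of_real r * z) ^ (k - i)))
          = (\<Sum>i\<le>k. of_real (((\<alpha> gchoose i) * (-1) ^ i)
                * ((\<alpha> gchoose (k - i)) * r ^ (k - i))) * z ^ k)"
        by (intro sum.cong) auto
      then show ?thesis
        unfolding c_def by (simp only: sum_distrib_right[symmetric]) (simp add: mult.assoc)
    qed
    ultimately show ?thesis by simp
  qed
  then show "\<exists>c :: nat \<Rightarrow> real. \<forall>z::complex. norm z < 1 \<longrightarrow>
      (\<lambda>l. of_real (c l) * z ^ l) sums (W2 \<alpha> z powr of_real \<alpha>)" by blast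
next
  fix c d :: "nat \<Rightarrow> real"
  assume c: "\<forall>z::complex. norm z < 1 \<longrightarrow> (\<lambda>l. of_real (c l) * z ^ l) sums (W2 \<alpha> z powr of_real \<alpha>)"
    and d: "\<forall>z::complex. norm z < 1 \<longrightarrow> (\<lambda>l. of_real (d l) * z ^ l) sums (W2 \<alpha> z powr of_real \<alpha>)"
  let ?F = "\<lambda>e :: nat \<Rightarrow> real. Abs_fps (\<lambda>l. complex_of_real (e l))"
  have rad: "fps_conv_radius (?F e) > 0"
    if "\<forall>z::complex. norm z < 1 \<longrightarrow> (\<lambda>l. of_real (e l) * z ^ l) sums (W2 \<alpha> z powr of_real \<alpha>)"
    for e
  proof -
    have "summable (\<lambda>l. complex_of_real (e l) * (1 / 2) ^ l)"
      using that[rule_format, of "1 / 2"] by (simp add: sums_iff)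
    from conv_radius_geI[OF this] have "ereal (1 / 2) \<le> fps_conv_radius (?F e)"
      by (simp add: fps_conv_radius_def)
    moreover have "(0::ereal) < ereal (1 / 2)" by simp
    ultimately show ?thesis by (rule less_le_trans[rotated])
  qed
  have "eventually (\<lambda>z::complex. z \<in> ball 0 1) (nhds 0)"
    by (intro eventually_nhds_in_open) auto
  then have "eventually (\<lambda>z. eval_fps (?F c) z = eval_fps (?F d) z) (nhds 0)"
    by eventually_elim (use c d in \<open>simp add: eval_fps_def sums_iff\<close>)
  then have "?F c = ?F d"
    using eval_fps_eqD[OF rad[OF c] rad[OF d]] by blast
  then have "complex_of_real (c n) = complex_of_real (d n)" for n
    by (metis fps_nth_Abs_fps)
  then show "c = d" by auto
qed

lemma kappa2_sums:
  assumes "1 < \<alpha>" "\<alpha> < 2" "norm (z::complex) < 1"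
  shows "(\<lambda>l. of_real (kappa2 \<alpha> l) * z ^ l) sums (W2 \<alpha> z powr of_real \<alpha>)"
  using theI'[OF ex1_kappa2[OF assms(1,2)]] assms(3) unfolding kappa2_def by blast

end

theory Submission
  imports Defs
begin

text \<open>The proof is an energy estimate. The difference \<open>e\<close> of two solutions solves the homogeneous scheme
  and vanishes at the two end points. Take the inner product of that scheme with the midpoint average
  \<open>m\<close> of \<open>e\<close>. Since the form of \<open>Lop\<close> is symmetric, the left-hand side is the increment of the energy
  \<open>(Lop e, e)\<close> divided by \<open>2 \<tau>\<close>; the right-hand side is \<open>- (Lop m, m) + K (delta_x m, m)\<close>. As
  \<open>0 \<le> \<sigma>\<^sub>2 < 1 / 4\<close>, the energy lies between \<open>(1 - 4 \<sigma>\<^sub>2)\<close> times the squared norm and the squared norm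
  (\<open>energy_bounds\<close>). Hence, once \<open>(delta_x m, m) \<le> 0\<close> is known (\<open>sum_delta_x_nonpos\<close>), the energy does
  not increase (\<open>energy_antimono\<close>), which gives stability with the constant \<open>1 / sqrt (1 - 4 \<sigma>\<^sub>2)\<close>.

  The sign of \<open>(delta_x m, m)\<close> is that of a Toeplitz form whose symbol is the real part of
  \<open>cnj z * W2 \<alpha> z powr \<alpha>\<close> on the unit circle. Writing \<open>W2 \<alpha> z\<close> as a positive multiple of
  \<open>(1 - z) (1 + r z)\<close>, one can bound the argument: on the upper half circle, except at \<open>z = 1\<close>, it lies between \<open>- \<pi>\<close> and
  \<open>- \<alpha> \<pi> / 2\<close>, so that the real part is nonpositive (\<open>Re_symbol_nonpos\<close>). To pass from the symbol to
  the form, the series of the symbol is needed on the circle itself. It converges absolutely there,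
  because the binomial series with exponent between \<open>1\<close> and \<open>2\<close> does (\<open>kappa2_closed_disc\<close>). The form
  of a truncation of the series is an average over roots of unity of sufficiently high order, and the
  truncation error tends to \<open>0\<close> (\<open>hess_form_nonpos\<close>).\<close>

section \<open>The binomial series on the closed unit disc\<close>

lemma gbinomial_signed_Suc:
  fixes a :: real
  shows "(-1) ^ Suc n * (a gchoose Suc n) = (-1) ^ n * (a gchoose n) * ((real n - a) / real (Suc n))"
proof -
  have "real (Suc n) * (a gchoose Suc n) = (a - real n) * (a gchoose n)"
    using gbinomial_mult_1[of a n] by (simp add: algebra_simps)
  then have "a gchoose Suc n = (a - real n) * (a gchoose n) / real (Suc n)"
    by (simp add: field_simps)
  also have "\<dots> = - ((a gchoose n) * ((real n - a) / real (Suc n)))"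
    by (simp add: divide_simps algebra_simps)
  finally show ?thesis by simp
qed

lemma gbinomial_signed_nonneg:
  fixes a :: real
  assumes "1 < a" "a < 2" "n \<ge> 2"
  shows "(-1) ^ n * (a gchoose n) \<ge> 0"
  using assms(3)
proof (induction n rule: dec_induct)
  case base
  show ?case
    using assms unfolding numeral_2_eq_2 gbinomial_signed_Suc by (simp add: mult_le_0_iff)
next
  case (step n)
  then show ?case
    unfolding gbinomial_signed_Suc using assms by (intro mult_nonneg_nonneg[OF _ divide_nonneg_nonneg]) auto
qed

lemma gbinomial_signed_nonpos:
  fixes a :: real
  assumes "0 < a" "a < 1" "n \<ge> 1"
  shows "(-1) ^ n * (a gchoose n) \<le> 0"
  using assms(3)
proof (induction n rule: dec_induct)
  case base
  then show ?case using assms by simp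
next
  case (step n)
  then show ?case
    unfolding gbinomial_signed_Suc using assms by (intro mult_nonpos_nonneg[OF _ divide_nonneg_nonneg]) auto
qed

text \<open>From index \<open>2\<close> on, the terms of \<open>\<Sum>n. (-1)\<^sup>n (a gchoose n)\<close> are nonnegative, and the partial
  sums are the signed binomial coefficients of \<open>a - 1 \<in> (0, 1)\<close>, which are nonpositive.\<close>

lemma summable_abs_gbinomial:
  fixes a :: real
  assumes "1 < a" "a < 2"
  shows "summable (\<lambda>n. \<bar>a gchoose n\<bar>)"
proof -
  have abs_eq: "\<bar>a gchoose n\<bar> = (-1) ^ n * (a gchoose n)" if "n \<ge> 2" for n
  proof -
    have "\<bar>a gchoose n\<bar> = \<bar>(-1) ^ n * (a gchoose n)\<bar>" by (simp add: abs_mult)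
    then show ?thesis using gbinomial_signed_nonneg[OF assms that] by simp
  qed
  have "summable (\<lambda>n. \<bar>a gchoose (n + 2)\<bar>)"
  proof (rule summableI_nonneg_bounded)
    fix n
    have "(\<Sum>i<n. \<bar>a gchoose (i + 2)\<bar>) = (\<Sum>i<n. (-1) ^ (i + 2) * (a gchoose (i + 2)))"
      by (intro sum.cong refl abs_eq) simp
    also have "\<dots> = (\<Sum>i<n + 2. (-1) ^ i * (a gchoose i)) - (1 - a)"
      by (simp add: sum.lessThan_Suc_shift del: sum.lessThan_Suc)
    also have "{..<n + 2} = {..n + 1}"
      by auto
    also have "(\<Sum>i\<le>n + 1. (-1) ^ i * (a gchoose i)) = (-1) ^ (n + 1) * (a - 1 gchoose (n + 1))"
      using gbinomial_sum_lower_neg[of a "n + 1"] by (simp only: mult.commute)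
    also have "\<dots> - (1 - a) \<le> a - 1"
      using gbinomial_signed_nonpos[of "a - 1" "n + 1"] assms by simp
    finally show "(\<Sum>i<n. \<bar>a gchoose (i + 2)\<bar>) \<le> a - 1" .
  qed simp
  then show ?thesis by (subst (asm) summable_iff_shift)
qed

lemma continuous_on_powser_cball:
  fixes c :: "nat \<Rightarrow> real"
  assumes "summable (\<lambda>n. \<bar>c n\<bar>)"
  shows "continuous_on (cball 0 1) (\<lambda>z::complex. \<Sum>n. of_real (c n) * z ^ n)"
proof (rule uniform_limit_theorem[OF _ Weierstrass_m_test])
  show "norm (complex_of_real (c n) * z ^ n) \<le> \<bar>c n\<bar>" if "z \<in> cball 0 1" for n z
    using that by (auto simp: norm_mult norm_power intro!: mult_left_le power_le_one)
qed (use assms in \<open>auto intro!: always_eventually continuous_intros\<close>)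

text \<open>Both sides are continuous on the closed disc, at \<open>z = -1\<close> because \<open>a > 0\<close>, and they agree on
  the open disc.\<close>

lemma gen_binomial_complex_cball:
  fixes z :: complex
  assumes "1 < a" "a < 2" "norm z \<le> 1"
  shows "(\<lambda>n. of_real (a gchoose n) * z ^ n) sums (1 + z) powr of_real a"
proof -
  let ?F = "\<lambda>z::complex. \<Sum>n. of_real (a gchoose n) * z ^ n"
  note summ = summable_abs_gbinomial[OF assms(1,2)]
  have gb: "(of_real a :: complex) gchoose n = of_real (a gchoose n)" for n
    by (simp add: gbinomial_prod_rev)
  have "?F z - (1 + z) powr of_real a = 0"
  proof (rule continuous_constant_on_closure[where S = "ball 0 1" and x = z
        and f = "\<lambda>z. ?F z - (1 + z) powr of_real a"])
    show "continuous_on (closure (ball 0 1)) (\<lambda>z. ?F z - (1 + z) powr of_real a)"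
    proof (rule continuous_on_diff)
      have "Re (1 + z) \<ge> 0" if "norm z \<le> 1" for z :: complex
        using abs_Re_le_cmod[of z] that by simp
      then show "continuous_on (closure (ball 0 1)) (\<lambda>z::complex. (1 + z) powr of_real a)"
        using assms by (intro continuous_on_powr_complex continuous_intros) auto
    qed (use continuous_on_powser_cball[OF summ] in simp)
    show "?F z - (1 + z) powr of_real a = 0" if "z \<in> ball 0 1" for z
      using gen_binomial_complex[of z "of_real a"] that by (simp add: gb sums_iff)
  qed (use assms in auto)
  moreover have "summable (\<lambda>n. norm (complex_of_real (a gchoose n) * z ^ n))"
    by (rule summable_comparison_test'[OF summ])
      (use assms in \<open>auto simp: norm_mult norm_power intro!: mult_left_le power_le_one\<close>)
  ultimately show ?thesis
    using summable_norm_cancel by (simp add: sums_iff)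
qed

lemma kappa2_unique:
  assumes "1 < \<alpha>" "\<alpha> < 2"
    and "\<And>z::complex. norm z < 1 \<Longrightarrow> (\<lambda>l. of_real (c l) * z ^ l) sums (W2 \<alpha> z powr of_real \<alpha>)"
  shows "kappa2 \<alpha> = c"
  using ex1_kappa2[OF assms(1,2)] kappa2_sums[OF assms(1,2)] assms(3) by blast

text \<open>The coefficients are the Cauchy product of the binomial coefficients of the two linear factors
  of \<open>W2\<close>. Both of these series converge absolutely on the closed disc, hence so does the product.\<close>

lemma kappa2_closed_disc:
  assumes \<alpha>: "1 < \<alpha>" "\<alpha> < 2"
  defines "a \<equiv> (3 * \<alpha> - 2) / (2 * \<alpha>)" and "r \<equiv> (2 - \<alpha>) / (3 * \<alpha> - 2)"
  shows "summable (\<lambda>l. \<bar>kappa2 \<alpha> l\<bar>)"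
    and "norm (z::complex) \<le> 1 \<Longrightarrow> (\<lambda>l. of_real (kappa2 \<alpha> l) * z ^ l) sums
      (of_real (a powr \<alpha>) * ((1 - z) powr of_real \<alpha> * (1 + of_real r * z) powr of_real \<alpha>))"
proof -
  have a: "a > 0" and r: "0 < r" "r < 1"
    using \<alpha> by (auto simp: a_def r_def divide_simps)
  define A B where "A i = (-1) ^ i * (\<alpha> gchoose i)" and "B i = r ^ i * (\<alpha> gchoose i)" for i
  define c where "c n = a powr \<alpha> * (\<Sum>i\<le>n. A i * B (n - i))" for n
  note summ = summable_abs_gbinomial[OF \<alpha>]
  have sA: "summable (\<lambda>i. \<bar>A i\<bar>)"
    using summ by (simp add: A_def abs_mult power_abs)
  have sB: "summable (\<lambda>i. \<bar>B i\<bar>)"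
    by (rule summable_comparison_test'[OF summ])
      (use r in \<open>auto simp: B_def abs_mult power_abs intro!: mult_left_le_one_le power_le_one\<close>)
  have sums_c: "(\<lambda>l. of_real (c l) * z ^ l) sums
      (of_real (a powr \<alpha>) * ((1 - z) powr of_real \<alpha> * (1 + of_real r * z) powr of_real \<alpha>))"
    if z: "norm z \<le> 1" for z :: complex
  proof -
    have sz: "summable (\<lambda>n. norm (complex_of_real (b n) * z ^ n))" if "summable (\<lambda>n. \<bar>b n\<bar>)" for b
      by (rule summable_comparison_test'[OF that])
        (use z in \<open>auto simp: norm_mult norm_power intro!: mult_left_le power_le_one\<close>)
    have "norm (of_real r * z) \<le> 1"
      using z r by (simp add: norm_mult mult_le_one)
    from gen_binomial_complex_cball[OF \<alpha> this]
    have B: "(\<lambda>n. of_real (B n) * z ^ n) sums (1 + of_real r * z) powr of_real \<alpha>"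
      by (simp add: B_def power_mult_distrib mult_ac)
    have A: "(\<lambda>n. of_real (A n) * z ^ n) sums (1 - z) powr of_real \<alpha>"
      using gen_binomial_complex_cball[OF \<alpha>, of "- z"] z
      by (simp add: A_def power_minus[of z] mult_ac)
    have "(\<lambda>n. of_real (a powr \<alpha>) * (\<Sum>i\<le>n. (of_real (A i) * z ^ i) * (of_real (B (n - i)) * z ^ (n - i))))
        sums (of_real (a powr \<alpha>) * ((1 - z) powr of_real \<alpha> * (1 + of_real r * z) powr of_real \<alpha>))"
      using Cauchy_product_sums[OF sz[OF sA] sz[OF sB]] A B by (intro sums_mult) (simp add: sums_iff)
    moreover have "(\<Sum>i\<le>n. (of_real (A i) * z ^ i) * (of_real (B (n - i)) * z ^ (n - i)))
        = of_real (\<Sum>i\<le>n. A i * B (n - i)) * z ^ n" for n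
      unfolding of_real_sum sum_distrib_right
      by (intro sum.cong) (auto simp: power_add[symmetric] mult_ac)
    ultimately show ?thesis by (simp add: c_def mult.assoc)
  qed
  have "kappa2 \<alpha> = c"
  proof (rule kappa2_unique[OF \<alpha>])
    fix z :: complex assume z: "norm z < 1"
    have "r * norm z \<le> norm z"
      using r by (intro mult_left_le_one_le) auto
    then have nrz: "norm (of_real r * z) < 1"
      using z r by (simp add: norm_mult)
    have pos: "Re (1 + x) > 0" if "norm x < 1" for x :: complex
      using abs_Re_le_cmod[of x] that by simp
    have "Re (1 - z) > 0" "Re (1 + of_real r * z) > 0"
      using pos[of "- z"] pos[OF nrz] z by auto
    then have "W2 \<alpha> z powr of_real \<alpha> = of_real (a powr \<alpha>) *
        ((1 - z) powr of_real \<alpha> * (1 + of_real r * z) powr of_real \<alpha>)"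
      unfolding W2_factor[OF \<alpha>] a_def[symmetric] r_def[symmetric]
      using a powr_mult_Re_pos[of "1 - z" "1 + of_real r * z" "of_real \<alpha>"]
      by (subst powr_times_real_left) (simp_all add: powr_of_real)
    then show "(\<lambda>l. of_real (c l) * z ^ l) sums (W2 \<alpha> z powr of_real \<alpha>)"
      using sums_c[of z] z by simp
  qed
  moreover have "summable (\<lambda>n. \<bar>c n\<bar>)"
  proof (rule summable_comparison_test')
    show "summable (\<lambda>n. a powr \<alpha> * (\<Sum>i\<le>n. \<bar>A i\<bar> * \<bar>B (n - i)\<bar>))"
      using summable_Cauchy_product[of "\<lambda>i. \<bar>A i\<bar>" "\<lambda>i. \<bar>B i\<bar>"] sA sB
      by (intro summable_mult) simp
    show "norm \<bar>c n\<bar> \<le> a powr \<alpha> * (\<Sum>i\<le>n. \<bar>A i\<bar> * \<bar>B (n - i)\<bar>)" if "n \<ge> 0" for n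
    proof -
      have "\<bar>\<Sum>i\<le>n. A i * B (n - i)\<bar> \<le> (\<Sum>i\<le>n. \<bar>A i\<bar> * \<bar>B (n - i)\<bar>)"
        unfolding abs_mult[symmetric] by (rule sum_abs)
      then show ?thesis
        by (simp add: c_def abs_mult mult_left_mono)
    qed
  qed
  ultimately show "summable (\<lambda>l. \<bar>kappa2 \<alpha> l\<bar>)"
    and "norm (z::complex) \<le> 1 \<Longrightarrow> (\<lambda>l. of_real (kappa2 \<alpha> l) * z ^ l) sums
      (of_real (a powr \<alpha>) * ((1 - z) powr of_real \<alpha> * (1 + of_real r * z) powr of_real \<alpha>))"
    using sums_c by auto
qed

section \<open>The sign of the symbol on the unit circle\<close>

text \<open>The derivative of the argument in \<open>\<theta>\<close> is \<open>r (r + cos \<theta>) / (1 + 2 r cos \<theta> + r\<^sup>2)\<close>, which is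
  largest at \<open>\<theta> = 0\<close>.\<close>

lemma Arg_one_plus_cis_bounds:
  fixes r \<theta> :: real
  assumes r: "0 \<le> r" "r < 1" and \<theta>: "0 \<le> \<theta>" "\<theta> \<le> pi"
  shows "0 \<le> Arg (1 + of_real r * cis \<theta>)" "Arg (1 + of_real r * cis \<theta>) \<le> \<theta> * (r / (1 + r))"
proof -
  have pos: "1 + r * cos t > 0" for t
    using mult_left_mono[OF cos_ge_minus_one[of t] r(1)] r by linarith
  have eq: "Arg (1 + of_real r * cis \<theta>) = arctan (r * sin \<theta> / (1 + r * cos \<theta>))"
    using pos[of \<theta>] by (subst arg_conv_arctan) auto
  show "0 \<le> Arg (1 + of_real r * cis \<theta>)"
    unfolding eq using pos[of \<theta>] r \<theta> by (simp add: sin_ge_zero)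
  define F where "F t = t * (r / (1 + r)) - arctan (r * sin t / (1 + r * cos t))" for t
  have "F 0 \<le> F \<theta>"
  proof (rule DERIV_nonneg_imp_nondecreasing[OF \<theta>(1)], intro exI conjI)
    fix t
    let ?p = "1 + r * cos t"
    let ?D = "(r * cos t * ?p + (r * sin t) * (r * sin t)) / (?p * ?p) / (1 + (r * sin t / ?p)\<^sup>2)"
    have p: "?p > 0" by (rule pos)
    have "((\<lambda>t. r * sin t / (1 + r * cos t)) has_real_derivative
        (r * cos t * ?p + (r * sin t) * (r * sin t)) / (?p * ?p)) (at t)"
      using p by (auto intro!: derivative_eq_intros)
    from DERIV_chain2[OF DERIV_arctan this]
    have "((\<lambda>t. arctan (r * sin t / (1 + r * cos t))) has_real_derivative ?D) (at t)"
      by (simp add: divide_inverse mult_ac)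
    moreover have "((\<lambda>t. t * (r / (1 + r))) has_real_derivative r / (1 + r)) (at t)"
      using DERIV_cmult_right[OF DERIV_ident, of "r / (1 + r)"] by simp
    ultimately show "(F has_real_derivative (r / (1 + r) - ?D)) (at t)"
      unfolding F_def by (intro DERIV_diff)
    have sc: "sin t * sin t = 1 - cos t * cos t"
      using sin_cos_squared_add[of t] by (simp add: power2_eq_square)
    have quot: "x / (q * q) / (1 + (y / q)\<^sup>2) = x / (q * q + y * y)" if "q > 0" for x y q :: real
    proof -
      have "1 + (y / q)\<^sup>2 = (q * q + y * y) / (q * q)"
        using that by (simp add: add_divide_distrib power2_eq_square)
      then show ?thesis using that by simp
    qed
    have "?p * ?p + (r * sin t) * (r * sin t) = ?p * ?p + r * r * (sin t * sin t)"
      by (simp only: mult_ac)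
    also have "\<dots> = 1 + 2 * r * cos t + r\<^sup>2"
      unfolding sc by (simp add: power2_eq_square algebra_simps)
    finally have den: "?p * ?p + (r * sin t) * (r * sin t) = 1 + 2 * r * cos t + r\<^sup>2" .
    have "r * cos t * ?p + (r * sin t) * (r * sin t) = r * cos t * ?p + r * r * (sin t * sin t)"
      by (simp only: mult_ac)
    also have "\<dots> = r * (cos t + r)"
      unfolding sc by (simp add: algebra_simps)
    finally have num: "r * cos t * ?p + (r * sin t) * (r * sin t) = r * (cos t + r)" .
    have D: "?D = r * (cos t + r) / (1 + 2 * r * cos t + r\<^sup>2)"
      unfolding quot[OF p] den num ..
    have "1 + 2 * r * cos t + r\<^sup>2 > 0"
    proof -
      have "1 + 2 * r * cos t + r\<^sup>2 = (1 - r)\<^sup>2 + 2 * r * (1 + cos t)"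
        by (simp add: power2_eq_square algebra_simps)
      moreover have "(1 - r)\<^sup>2 > 0" using r by simp
      moreover have "2 * r * (1 + cos t) \<ge> 0"
        using r cos_ge_minus_one[of t] by (intro mult_nonneg_nonneg; linarith)
      ultimately show ?thesis by linarith
    qed
    moreover have "r * (cos t + r) * (1 + r) \<le> r * (1 + 2 * r * cos t + r\<^sup>2)"
    proof -
      have "r * (1 + 2 * r * cos t + r\<^sup>2) - r * (cos t + r) * (1 + r) = r * ((1 - r) * (1 - cos t))"
        by (simp add: power2_eq_square algebra_simps)
      moreover have "r * ((1 - r) * (1 - cos t)) \<ge> 0"
        using r by (intro mult_nonneg_nonneg) auto
      ultimately show ?thesis by linarith
    qed
    ultimately have "r * (cos t + r) / (1 + 2 * r * cos t + r\<^sup>2) \<le> r / (1 + r)"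
      using r by (subst pos_divide_le_eq) (simp_all add: pos_le_divide_eq)
    then show "0 \<le> r / (1 + r) - ?D" unfolding D by simp
  qed
  then show "Arg (1 + of_real r * cis \<theta>) \<le> \<theta> * (r / (1 + r))"
    unfolding eq by (simp add: F_def)
qed

lemma Arg_one_minus_cis:
  assumes "0 < \<theta>" "\<theta> \<le> pi"
  shows "Arg (1 - cis \<theta>) = (\<theta> - pi) / 2"
proof (rule Arg_unique')
  show "2 * sin (\<theta> / 2) > 0"
    using assms by (auto intro: sin_gt_zero)
  show "(\<theta> - pi) / 2 \<in> {- pi<..pi}"
    using assms by auto
  have "cos \<theta> = 1 - 2 * (sin (\<theta> / 2))\<^sup>2" "sin \<theta> = 2 * sin (\<theta> / 2) * cos (\<theta> / 2)"
    using cos_double_sin[of "\<theta> / 2"] sin_double[of "\<theta> / 2"] by simp_all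
  moreover have "cos ((\<theta> - pi) / 2) = sin (\<theta> / 2)" "sin ((\<theta> - pi) / 2) = - cos (\<theta> / 2)"
    by (simp_all add: diff_divide_distrib cos_diff sin_diff)
  ultimately show "1 - cis \<theta> = rcis (2 * sin (\<theta> / 2)) ((\<theta> - pi) / 2)"
    by (simp add: complex_eq_iff power2_eq_square)
qed

lemma powr_of_real_polar:
  fixes z :: complex
  assumes "z \<noteq> 0"
  shows "z powr of_real a = rcis (norm z powr a) (a * Arg z)"
proof -
  have "z powr of_real a = exp (of_real a * Ln z)"
    using assms by (simp add: powr_def)
  also have "\<dots> = rcis (exp (a * ln (norm z))) (a * Arg z)"
    using assms by (simp add: exp_eq_polar rcis_def Arg_eq_Im_Ln)
  finally show ?thesis
    using assms by (simp add: powr_def)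
qed

text \<open>On the upper half circle, for \<open>z \<noteq> 1\<close>, write \<open>z = cis \<theta>\<close>. The argument of the product is
  \<open>\<phi> = \<alpha> (\<theta> - \<pi>) / 2 + \<alpha> \<psi> - \<theta>\<close>, where \<open>\<psi>\<close> is the argument of \<open>1 + r z\<close>. The value of \<open>r\<close> is such that
  \<open>\<alpha> r / (1 + r) = 1 - \<alpha> / 2\<close>, so the bound \<open>\<psi> \<le> \<theta> r / (1 + r)\<close> cancels all the terms in \<open>\<theta>\<close> and
  leaves \<open>\<phi> \<le> - \<alpha> \<pi> / 2\<close>.\<close>

lemma Re_symbol_nonpos:
  fixes z :: complex
  assumes \<alpha>: "1 < \<alpha>" "\<alpha> < 2" and z: "norm z = 1"
  defines "r \<equiv> (2 - \<alpha>) / (3 * \<alpha> - 2)"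
  shows "Re (cnj z * ((1 - z) powr of_real \<alpha> * (1 + of_real r * z) powr of_real \<alpha>)) \<le> 0"
proof -
  have r: "0 < r" "r < 1" and r': "\<alpha> * (r / (1 + r)) = 1 - \<alpha> / 2"
    using \<alpha> by (auto simp: r_def divide_simps)
  define G where "G z = cnj z * ((1 - z) powr of_real \<alpha> * (1 + of_real r * z) powr of_real \<alpha>)" for z
  have upper: "Re (G z) \<le> 0" if z: "norm z = 1" "Im z \<ge> 0" for z
  proof (cases "z = 1")
    case True
    then show ?thesis by (simp add: G_def)
  next
    case False
    define \<theta> where "\<theta> = Arg z"
    have z_cis: "z = cis \<theta>"
      using z cis_Arg[of z] by (cases "z = 0") (simp_all add: \<theta>_def sgn_eq)
    have "\<theta> \<noteq> 0"
      using False z_cis by auto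
    then have \<theta>: "0 < \<theta>" "\<theta> \<le> pi"
      using z Arg_less_0[of z] Arg_bounded[of z] by (auto simp: \<theta>_def)
    define \<psi> where "\<psi> = Arg (1 + of_real r * cis \<theta>)"
    define \<phi> where "\<phi> = \<alpha> * ((\<theta> - pi) / 2) + \<alpha> * \<psi> - \<theta>"
    have \<psi>: "0 \<le> \<psi>" "\<psi> \<le> \<theta> * (r / (1 + r))"
      using Arg_one_plus_cis_bounds[of r \<theta>] r \<theta> by (auto simp: \<psi>_def)
    have "\<alpha> * \<psi> \<le> \<theta> * (\<alpha> * (r / (1 + r)))"
      using mult_left_mono[OF \<psi>(2), of \<alpha>] \<alpha> by (simp add: mult_ac)
    then have "\<phi> \<le> - (\<alpha> * pi / 2)"
      unfolding r' \<phi>_def by (simp add: field_simps)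
    also have "\<dots> \<le> - (pi / 2)"
      using \<alpha> by simp
    finally have "\<phi> \<le> - (pi / 2)" .
    moreover have "- pi \<le> \<phi>"
    proof -
      have "\<alpha> * \<psi> \<ge> 0" "(2 - \<alpha>) * (pi - \<theta>) \<ge> 0"
        using \<psi> \<alpha> \<theta> by auto
      then show ?thesis by (simp add: \<phi>_def field_simps)
    qed
    ultimately have cos_\<phi>: "cos \<phi> \<le> 0"
      using cos_monotone_0_pi_le[of "pi / 2" "- \<phi>"] by simp
    have nz: "1 - cis \<theta> \<noteq> 0" "1 + of_real r * cis \<theta> \<noteq> 0"
    proof -
      show "1 - cis \<theta> \<noteq> 0" using False z_cis by auto
      have "norm (of_real r * cis \<theta>) < 1" using r by (simp add: norm_mult)
      then show "1 + of_real r * cis \<theta> \<noteq> 0"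
        by (metis add_eq_0_iff less_irrefl norm_minus_cancel norm_one)
    qed
    have "G z = cis (- \<theta>) * (rcis (norm (1 - cis \<theta>) powr \<alpha>) (\<alpha> * ((\<theta> - pi) / 2))
        * rcis (norm (1 + of_real r * cis \<theta>) powr \<alpha>) (\<alpha> * \<psi>))"
      by (simp only: G_def z_cis powr_of_real_polar[OF nz(1)] powr_of_real_polar[OF nz(2)]
          Arg_one_minus_cis[OF \<theta>] \<psi>_def cis_cnj)
    also have "\<dots> = rcis (norm (1 - cis \<theta>) powr \<alpha> * norm (1 + of_real r * cis \<theta>) powr \<alpha>) \<phi>"
      unfolding cis_rcis_eq[of "- \<theta>"] rcis_mult by (simp add: \<phi>_def)
    finally have "Re (G z) = norm (1 - cis \<theta>) powr \<alpha> * norm (1 + of_real r * cis \<theta>) powr \<alpha> * cos \<phi>"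
      by simp
    then show ?thesis
      using cos_\<phi> by (simp add: mult_nonneg_nonpos)
  qed
  \<comment> \<open>The lower half circle follows by complex conjugation.\<close>
  have "Re (G z) \<le> 0"
  proof (cases "Im z \<ge> 0")
    case True
    then show ?thesis using upper z by simp
  next
    case False
    have "Re (1 - z) \<ge> 0" "Re (1 + of_real r * z) \<ge> 0"
    proof -
      have "\<bar>Re z\<bar> \<le> 1" using abs_Re_le_cmod[of z] z by simp
      moreover then have "\<bar>r * Re z\<bar> \<le> 1"
        using r by (simp add: abs_mult mult_le_one)
      ultimately show "Re (1 - z) \<ge> 0" "Re (1 + of_real r * z) \<ge> 0" by auto
    qed
    then have "G (cnj z) = cnj (G z)"
      by (simp add: G_def cnj_powr)
    then show ?thesis using upper[of "cnj z"] z False by simp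
  qed
  then show ?thesis by (simp add: G_def)
qed

section \<open>Toeplitz forms and roots of unity\<close>

lemma sum_roots_of_unity_power:
  fixes a b P :: nat
  assumes "a < b + P" "b < a + P"
  defines "\<zeta> \<equiv> \<lambda>s. cis (2 * pi * real s / real P)"
  shows "(\<Sum>s<P. \<zeta> s ^ a * cnj (\<zeta> s) ^ b) = (if a = b then of_nat P else 0)"
proof -
  have P: "P > 0" using assms by linarith
  define q where "q = cis (2 * pi * (real a - real b) / real P)"
  have q: "\<zeta> s ^ a * cnj (\<zeta> s) ^ b = q ^ s" for s
  proof -
    have "\<zeta> s ^ a * cnj (\<zeta> s) ^ b
        = cis (real a * (2 * pi * real s / real P) + real b * - (2 * pi * real s / real P))"
      by (simp only: \<zeta>_def cis_cnj Complex.DeMoivre cis_mult)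
    also have "real a * (2 * pi * real s / real P) + real b * - (2 * pi * real s / real P)
        = real s * (2 * pi * (real a - real b) / real P)"
      using P by (simp add: field_simps)
    finally show ?thesis by (simp only: q_def Complex.DeMoivre)
  qed
  have "(\<Sum>s<P. q ^ s) = (if a = b then of_nat P else 0)"
  proof (cases "a = b")
    case True
    then show ?thesis by (simp add: q_def)
  next
    case False
    have "q \<noteq> 1"
    proof
      assume "q = 1"
      then have "cos (2 * pi * (real a - real b) / real P) = 1"
        by (metis Re_complex_of_real cis.sel(1) of_real_1 q_def)
      then obtain n :: int where "2 * pi * (real a - real b) / real P = of_int n * 2 * pi"
        unfolding cos_one_2pi_int by auto
      then have "(2 * pi) * ((real a - real b) / real P) = (2 * pi) * of_int n"
        by (simp only: times_divide_eq_right mult_ac)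
      then have "(real a - real b) / real P = of_int n"
        unfolding mult_cancel_left by simp
      then have "real a - real b = of_int n * real P"
        using P by (simp add: divide_eq_eq)
      then have "of_int (int a - int b) = (of_int (n * int P) :: real)"
        by simp
      then have n: "int a - int b = n * int P"
        by (simp only: of_int_eq_iff)
      have "\<bar>n * int P\<bar> < int P"
        unfolding n[symmetric] using assms(1,2) by linarith
      then have "\<bar>n\<bar> * int P < 1 * int P"
        by (simp only: abs_mult abs_of_nat mult_1)
      then have "n = 0"
        using P by simp
      then show False using n False by simp
    qed
    moreover have "q ^ P = 1"
    proof -
      have "q ^ P = cis (2 * pi * (real a - real b))"
        using P by (simp add: q_def Complex.DeMoivre)
      also have "\<dots> = 1" by (rule cis_multiple_2pi) auto
      finally show ?thesis .
    qed
    ultimately show ?thesis using False by (simp add: sum_gp_strict)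
  qed
  then show ?thesis by (simp add: q)
qed

text \<open>The quadratic form of the lower Hessenberg Toeplitz matrix with entry \<open>c (j + 1 - m)\<close> in row \<open>j\<close>
  and column \<open>m \<le> j + 1\<close>, both running over \<open>0..M\<close>. Only the coefficients up to \<open>c n\<close> are used; the
  matrix has none beyond \<open>c (M + 1)\<close>.\<close>

definition hess_form :: "(nat \<Rightarrow> real) \<Rightarrow> nat \<Rightarrow> nat \<Rightarrow> (nat \<Rightarrow> real) \<Rightarrow> real" where
  "hess_form c n M w = (\<Sum>j\<le>M. \<Sum>m\<le>M. \<Sum>l\<le>n. if m + l = j + 1 then c l * w j * w m else 0)"

lemma hess_form_truncate:
  assumes "n \<ge> M + 1"
  shows "hess_form c n M w = hess_form c (M + 1) M w"
  unfolding hess_form_def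
  by (intro sum.cong refl sum.mono_neutral_right) (use assms in auto)

text \<open>A discrete Parseval identity. The exponents \<open>m + l\<close> and \<open>j + 1\<close> that occur differ by less than
  \<open>P\<close>, so that sampling at the \<open>P\<close>-th roots of unity causes no aliasing.\<close>

lemma hess_form_roots_of_unity:
  fixes c w :: "nat \<Rightarrow> real" and n M :: nat
  defines "P \<equiv> M + n + 2"
  defines "\<zeta> \<equiv> \<lambda>s. cis (2 * pi * real s / real P)"
  shows "real P * hess_form c n M w =
    (\<Sum>s<P. Re (cnj (\<zeta> s) * (\<Sum>l\<le>n. of_real (c l) * \<zeta> s ^ l))
      * (norm (\<Sum>m\<le>M. of_real (w m) * \<zeta> s ^ m))\<^sup>2)"
proof -
  let ?S = "\<lambda>z::complex. \<Sum>l\<le>n. of_real (c l) * z ^ l"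
  let ?W = "\<lambda>z::complex. \<Sum>m\<le>M. of_real (w m) * z ^ m"
  have expand: "cnj z * ?S z * (?W z * cnj (?W z)) =
      (\<Sum>j\<le>M. \<Sum>m\<le>M. \<Sum>l\<le>n. of_real (c l * w j * w m) * (z ^ (m + l) * cnj z ^ (j + 1)))" for z
    unfolding cnj_sum
    by (simp add: sum_distrib_left sum_distrib_right power_add mult_ac)
  have "(\<Sum>s<P. cnj (\<zeta> s) * ?S (\<zeta> s) * (?W (\<zeta> s) * cnj (?W (\<zeta> s)))) =
      (\<Sum>j\<le>M. \<Sum>m\<le>M. \<Sum>l\<le>n. of_real (c l * w j * w m) * (\<Sum>s<P. \<zeta> s ^ (m + l) * cnj (\<zeta> s) ^ (j + 1)))"
    unfolding expand
    by (rule trans[OF sum.swap], rule sum.cong[OF refl], rule trans[OF sum.swap], rule sum.cong[OF refl],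
        rule trans[OF sum.swap], rule sum.cong[OF refl], simp only: sum_distrib_left)
  also have "\<dots> = (\<Sum>j\<le>M. \<Sum>m\<le>M. \<Sum>l\<le>n.
      of_real (real P * (if m + l = j + 1 then c l * w j * w m else 0)))"
    unfolding \<zeta>_def
    by (intro sum.cong refl, subst sum_roots_of_unity_power) (auto simp: P_def)
  also have "\<dots> = of_real (real P * hess_form c n M w)"
    by (simp only: hess_form_def sum_distrib_left of_real_sum)
  finally have "real P * hess_form c n M w =
      Re (\<Sum>s<P. cnj (\<zeta> s) * ?S (\<zeta> s) * (?W (\<zeta> s) * cnj (?W (\<zeta> s))))"
    by simp
  also have "\<dots> = (\<Sum>s<P. Re (cnj (\<zeta> s) * ?S (\<zeta> s)) * (norm (?W (\<zeta> s)))\<^sup>2)"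
    unfolding Re_sum complex_norm_square[symmetric] by simp
  finally show ?thesis .
qed

text \<open>The form does not depend on the truncation index \<open>n \<ge> M + 1\<close>, while the real part of the truncated
  symbol exceeds a nonpositive number by at most the tail of \<open>\<Sum>l. \<bar>c l\<bar>\<close>, which tends to \<open>0\<close>.\<close>

lemma hess_form_nonpos:
  fixes c w :: "nat \<Rightarrow> real"
  assumes summ: "summable (\<lambda>l. \<bar>c l\<bar>)"
    and symbol: "\<And>z::complex. norm z = 1 \<Longrightarrow> Re (cnj z * (\<Sum>l. of_real (c l) * z ^ l)) \<le> 0"
  shows "hess_form c (M + 1) M w \<le> 0"
proof -
  define B where "B = (\<Sum>m\<le>M. \<bar>w m\<bar>)"
  define tail where "tail n = (\<Sum>l. \<bar>c l\<bar>) - (\<Sum>l\<le>n. \<bar>c l\<bar>)" for n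
  have tail0: "tail \<longlonglongrightarrow> 0"
    unfolding tail_def
    using tendsto_diff[OF tendsto_const summable_LIMSEQ'[OF summ], of "\<Sum>l. \<bar>c l\<bar>"] by simp
  have bound: "hess_form c (M + 1) M w \<le> tail n * B\<^sup>2" if n: "n \<ge> M + 1" for n
  proof -
    define P where "P = M + n + 2"
    have tail_nonneg: "tail n \<ge> 0"
      unfolding tail_def using sum_le_suminf[OF summ, of "{..n}"] by simp
    have Re_le: "Re (cnj z * (\<Sum>l\<le>n. of_real (c l) * z ^ l)) \<le> tail n"
      if z: "norm z = 1" for z :: complex
    proof -
      have nrm: "norm (complex_of_real (c l) * z ^ l) = \<bar>c l\<bar>" for l
        using z by (simp add: norm_mult norm_power)
      have sz: "summable (\<lambda>l. complex_of_real (c l) * z ^ l)"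
        by (rule summable_norm_cancel) (simp only: nrm summ)
      define R where "R = (\<Sum>l. complex_of_real (c (l + Suc n)) * z ^ (l + Suc n))"
      have split: "(\<Sum>l. of_real (c l) * z ^ l) = R + (\<Sum>l\<le>n. of_real (c l) * z ^ l)"
        unfolding R_def using suminf_split_initial_segment[OF sz, of "Suc n"]
        by (simp only: lessThan_Suc_atMost)
      have "norm R \<le> (\<Sum>l. \<bar>c (l + Suc n)\<bar>)"
        unfolding R_def using summable_ignore_initial_segment[OF summ, of "Suc n"]
        by (intro order_trans[OF summable_norm]) (simp_all only: nrm order_refl)
      also have "\<dots> = tail n"
        unfolding tail_def using suminf_minus_initial_segment[OF summ, of "Suc n"]
        by (simp only: lessThan_Suc_atMost)
      finally have "norm R \<le> tail n" .
      moreover have "- Re (cnj z * R) \<le> norm R"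
        using abs_Re_le_cmod[of "cnj z * R"] z by (simp add: norm_mult)
      ultimately show ?thesis
        using symbol[OF z] unfolding split distrib_left by simp
    qed
    have W_le: "norm (\<Sum>m\<le>M. of_real (w m) * z ^ m) \<le> B" if "norm z = 1" for z :: complex
      unfolding B_def by (rule order_trans[OF norm_sum]) (simp add: norm_mult norm_power that)
    have "real P * hess_form c n M w \<le> (\<Sum>s<P. tail n * B\<^sup>2)"
      unfolding P_def hess_form_roots_of_unity
      by (intro sum_mono mult_mono Re_le power_mono W_le tail_nonneg) simp_all
    then have "real P * hess_form c n M w \<le> real P * (tail n * B\<^sup>2)"
      by simp
    then show ?thesis
      unfolding hess_form_truncate[OF n] by (simp add: P_def)
  qed
  have "(\<lambda>n. tail n * B\<^sup>2) \<longlonglongrightarrow> 0"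
    using tendsto_mult_left_zero[OF tail0] .
  then show ?thesis
    by (rule LIMSEQ_le_const) (use bound in blast)
qed

lemma sum_interior:
  fixes w X :: "nat \<Rightarrow> real"
  assumes "w 0 = 0" "w M = 0"
  shows "(\<Sum>j = 1..M - 1. w j * X j) = (\<Sum>j\<le>M. w j * X j)"
proof (rule sum.mono_neutral_left)
  show "\<forall>j\<in>{..M} - {1..M - 1}. w j * X j = 0"
  proof
    fix j assume "j \<in> {..M} - {1..M - 1}"
    then have "j = 0 \<or> j = M" by auto
    then show "w j * X j = 0" using assms by auto
  qed
qed auto

text \<open>The two one-sided sums in \<open>delta_x\<close> are the rows of the Hessenberg matrix and of its transpose,
  so both contribute the same quadratic form.\<close>

lemma hess_form_rows:
  assumes w: "w 0 = 0" "w M = 0"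
  shows "(\<Sum>j = 1..M - 1. w j * (\<Sum>l = 0..j + 1. c l * w (j + 1 - l))) = hess_form c (M + 1) M w"
proof -
  have "(\<Sum>l = 0..j + 1. c l * w (j + 1 - l)) =
      (\<Sum>m\<le>M. \<Sum>l\<le>M + 1. if m + l = j + 1 then c l * w m else 0)" if j: "j \<in> {1..M - 1}" for j
  proof -
    have "(\<Sum>m\<le>M. \<Sum>l\<le>M + 1. if m + l = j + 1 then c l * w m else 0)
        = (\<Sum>l\<le>M + 1. \<Sum>m\<le>M. if m + l = j + 1 then c l * w m else 0)"
      by (rule sum.swap)
    also have "\<dots> = (\<Sum>l\<le>M + 1. if l \<le> j + 1 then c l * w (j + 1 - l) else 0)"
    proof (intro sum.cong refl)
      fix l
      have "(\<Sum>m\<le>M. if m + l = j + 1 then c l * w m else 0)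
          = (\<Sum>m\<le>M. if m = j + 1 - l then (if l \<le> j + 1 then c l * w m else 0) else 0)"
        by (intro sum.cong) auto
      then show "(\<Sum>m\<le>M. if m + l = j + 1 then c l * w m else 0)
          = (if l \<le> j + 1 then c l * w (j + 1 - l) else 0)"
        using j by (auto simp: sum.delta)
    qed
    also have "\<dots> = (\<Sum>l = 0..j + 1. c l * w (j + 1 - l))"
      using j by (intro sum.mono_neutral_cong_right) auto
    finally show ?thesis ..
  qed
  then have "(\<Sum>j = 1..M - 1. w j * (\<Sum>l = 0..j + 1. c l * w (j + 1 - l)))
      = (\<Sum>j = 1..M - 1. w j * (\<Sum>m\<le>M. \<Sum>l\<le>M + 1. if m + l = j + 1 then c l * w m else 0))"
    by simp
  also have "\<dots> = (\<Sum>j\<le>M. w j * (\<Sum>m\<le>M. \<Sum>l\<le>M + 1. if m + l = j + 1 then c l * w m else 0))"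
    by (rule sum_interior[OF w])
  also have "\<dots> = hess_form c (M + 1) M w"
    unfolding hess_form_def sum_distrib_left by (intro sum.cong refl) simp
  finally show ?thesis .
qed

lemma hess_form_columns:
  assumes w: "w 0 = 0" "w M = 0"
  shows "(\<Sum>j = 1..M - 1. w j * (\<Sum>l = 0..M - j + 1. c l * w (j + l - 1))) = hess_form c (M + 1) M w"
proof -
  have "(\<Sum>l = 0..M - j + 1. c l * w (j + l - 1)) =
      (\<Sum>m\<le>M. \<Sum>l\<le>M + 1. if j + l = m + 1 then c l * w m else 0)" if j: "j \<in> {1..M - 1}" for j
  proof -
    have "(\<Sum>m\<le>M. \<Sum>l\<le>M + 1. if j + l = m + 1 then c l * w m else 0)
        = (\<Sum>l\<le>M + 1. \<Sum>m\<le>M. if j + l = m + 1 then c l * w m else 0)"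
      by (rule sum.swap)
    also have "\<dots> = (\<Sum>l\<le>M + 1. if l \<le> M - j + 1 then c l * w (j + l - 1) else 0)"
    proof (intro sum.cong refl)
      fix l
      have "(\<Sum>m\<le>M. if j + l = m + 1 then c l * w m else 0)
          = (\<Sum>m\<le>M. if m = j + l - 1 then c l * w m else 0)"
        using j by (intro sum.cong) auto
      then show "(\<Sum>m\<le>M. if j + l = m + 1 then c l * w m else 0)
          = (if l \<le> M - j + 1 then c l * w (j + l - 1) else 0)"
        using j by (auto simp: sum.delta)
    qed
    also have "\<dots> = (\<Sum>l = 0..M - j + 1. c l * w (j + l - 1))"
      using j by (intro sum.mono_neutral_cong_right) auto
    finally show ?thesis ..
  qed
  then have "(\<Sum>j = 1..M - 1. w j * (\<Sum>l = 0..M - j + 1. c l * w (j + l - 1)))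
      = (\<Sum>j = 1..M - 1. w j * (\<Sum>m\<le>M. \<Sum>l\<le>M + 1. if j + l = m + 1 then c l * w m else 0))"
    by simp
  also have "\<dots> = (\<Sum>j\<le>M. w j * (\<Sum>m\<le>M. \<Sum>l\<le>M + 1. if j + l = m + 1 then c l * w m else 0))"
    by (rule sum_interior[OF w])
  also have "\<dots> = (\<Sum>j\<le>M. \<Sum>m\<le>M. \<Sum>l\<le>M + 1. if j + l = m + 1 then c l * w m * w j else 0)"
    unfolding sum_distrib_left by (intro sum.cong refl) simp
  also have "\<dots> = hess_form c (M + 1) M w"
    unfolding hess_form_def by (rule sum.swap)
  finally show ?thesis .
qed

lemma Re_of_real_mult: "Re (of_real c * z) = c * Re z"
  by simp

lemma sum_delta_x_nonpos:
  assumes \<alpha>: "1 < \<alpha>" "\<alpha> < 2" and "h > 0" and w: "w 0 = 0" "w M = 0"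
  shows "(\<Sum>j = 1..M - 1. w j * delta_x \<alpha> h M w j) \<le> 0"
proof -
  define A where "A = - (1 / (2 * cos (pi * \<alpha> / 2) * h powr \<alpha>))"
  have "cos (pi * \<alpha> / 2) < cos (pi / 2)"
    using \<alpha> by (intro cos_monotone_0_pi) auto
  then have A: "A \<ge> 0"
    using \<open>h > 0\<close> by (simp add: A_def divide_nonneg_neg mult_neg_pos less_imp_le)
  have "hess_form (kappa2 \<alpha>) (M + 1) M w \<le> 0"
  proof (rule hess_form_nonpos[OF kappa2_closed_disc(1)[OF \<alpha>]])
    fix z :: complex assume z: "norm z = 1"
    let ?a = "(3 * \<alpha> - 2) / (2 * \<alpha>)" and ?r = "(2 - \<alpha>) / (3 * \<alpha> - 2)"
    have "cnj z * (\<Sum>l. of_real (kappa2 \<alpha> l) * z ^ l) = of_real (?a powr \<alpha>) *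
        (cnj z * ((1 - z) powr of_real \<alpha> * (1 + of_real ?r * z) powr of_real \<alpha>))"
      using kappa2_closed_disc(2)[OF \<alpha>, of z] z by (simp only: sums_iff order_refl mult.left_commute)
    then show "Re (cnj z * (\<Sum>l. of_real (kappa2 \<alpha> l) * z ^ l)) \<le> 0"
      using mult_nonneg_nonpos[OF powr_ge_zero Re_symbol_nonpos[OF \<alpha> z], of ?a \<alpha>] by (simp only: Re_of_real_mult)
  qed
  moreover have "(\<Sum>j = 1..M - 1. w j * delta_x \<alpha> h M w j) = A *
      ((\<Sum>j = 1..M - 1. w j * (\<Sum>l = 0..j + 1. kappa2 \<alpha> l * w (j + 1 - l)))
       + (\<Sum>j = 1..M - 1. w j * (\<Sum>l = 0..M - j + 1. kappa2 \<alpha> l * w (j + l - 1))))"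
    unfolding delta_x_def A_def[symmetric]
    by (simp only: distrib_left sum.distrib sum_distrib_left mult_ac)
  ultimately show ?thesis
    unfolding hess_form_rows[OF w] hess_form_columns[OF w]
    using A by (simp add: mult_nonneg_nonpos)
qed

section \<open>The compact operator and the energy\<close>

lemma sum_second_difference_by_parts:
  fixes u w :: "nat \<Rightarrow> real"
  assumes "u 0 = 0" "u M = 0" "M > 0"
  shows "(\<Sum>j = 1..M - 1. u j * (w (j + 1) - 2 * w j + w (j - 1)))
       = - (\<Sum>j<M. (u (j + 1) - u j) * (w (j + 1) - w j))"
proof -
  have "(\<Sum>j = 1..n. u j * (w (j + 1) - 2 * w j + w (j - 1)))
      = u (n + 1) * (w (n + 1) - w n) - u 0 * (w 1 - w 0)
        - (\<Sum>j<n + 1. (u (j + 1) - u j) * (w (j + 1) - w j))" for n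
    by (induction n) (simp_all add: algebra_simps)
  from this[of "M - 1"] assms show ?thesis by simp
qed

lemma sum_square_difference_le:
  fixes w :: "nat \<Rightarrow> real"
  assumes w: "w 0 = 0" "w M = 0" and "M > 0"
  shows "(\<Sum>j<M. (w (j + 1) - w j)\<^sup>2) \<le> 4 * (\<Sum>j = 1..M - 1. (w j)\<^sup>2)"
proof -
  have "(\<Sum>j<M. (w (j + 1) - w j)\<^sup>2) \<le> (\<Sum>j<M. 2 * (w (j + 1))\<^sup>2 + 2 * (w j)\<^sup>2)"
  proof (intro sum_mono)
    fix j
    have "0 \<le> (w (j + 1) + w j)\<^sup>2" by simp
    then show "(w (j + 1) - w j)\<^sup>2 \<le> 2 * (w (j + 1))\<^sup>2 + 2 * (w j)\<^sup>2"
      by (simp add: power2_sum power2_diff)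
  qed
  also have "\<dots> = 2 * (\<Sum>j<M. (w (j + 1))\<^sup>2) + 2 * (\<Sum>j<M. (w j)\<^sup>2)"
    by (simp add: sum.distrib sum_distrib_left)
  also have "(\<Sum>j<M. (w (j + 1))\<^sup>2) = (\<Sum>j = 1..M. (w j)\<^sup>2)"
    by (simp add: sum.atLeast1_atMost_eq)
  also have "\<dots> = (\<Sum>j = 1..M - 1. (w j)\<^sup>2)"
  proof (intro sum.mono_neutral_right ballI)
    fix j assume "j \<in> {1..M} - {1..M - 1}"
    then have "j = M" by auto
    then show "(w j)\<^sup>2 = 0" using w by simp
  qed auto
  also have "(\<Sum>j<M. (w j)\<^sup>2) = (\<Sum>j = 1..M - 1. (w j)\<^sup>2)"
    using w \<open>M > 0\<close> by (intro sum.mono_neutral_right) (auto simp: Suc_le_eq)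
  finally show ?thesis by simp
qed

lemma sigma2_bounds:
  assumes "1 < \<alpha>" "\<alpha> < 2"
  shows "0 \<le> sigma2 \<alpha>" "4 * sigma2 \<alpha> < 1"
proof -
  have "(\<alpha> - 1) * (2 - \<alpha>) \<ge> 0" using assms by simp
  then have "2 * \<alpha>\<^sup>2 - 6 * \<alpha> + 3 \<le> 0"
    by (simp add: power2_eq_square algebra_simps)
  then show "0 \<le> sigma2 \<alpha>"
    using assms by (simp add: sigma2_def divide_simps)
  \<comment> \<open>The second claim amounts to \<open>4 \<alpha>\<^sup>2 - 9 \<alpha> + 6 > 0\<close>, which holds on completing the square.\<close>
  have "(2 * \<alpha> - 9 / 4)\<^sup>2 \<ge> 0" by simp
  then have "- 4 * (2 * \<alpha>\<^sup>2 - 6 * \<alpha> + 3) < 6 * \<alpha>"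
    by (simp add: power2_eq_square algebra_simps)
  then show "4 * sigma2 \<alpha> < 1"
    using assms by (simp add: sigma2_def divide_simps)
qed

text \<open>The inner product of \<open>Lop \<alpha> w\<close> with \<open>w\<close>, without the factor \<open>h\<close> and already summed by parts, for
  a grid vector that vanishes at both ends.\<close>

definition energy :: "real \<Rightarrow> nat \<Rightarrow> (nat \<Rightarrow> real) \<Rightarrow> real" where
  "energy \<alpha> M w = (\<Sum>j = 1..M - 1. (w j)\<^sup>2) - sigma2 \<alpha> * (\<Sum>j<M. (w (j + 1) - w j)\<^sup>2)"

lemma sum_Lop_by_parts:
  assumes "u 0 = 0" "u M = 0" "M > 0"
  shows "(\<Sum>j = 1..M - 1. u j * Lop \<alpha> w j)
       = (\<Sum>j = 1..M - 1. u j * w j) - sigma2 \<alpha> * (\<Sum>j<M. (u (j + 1) - u j) * (w (j + 1) - w j))"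
proof -
  have "(\<Sum>j = 1..M - 1. u j * Lop \<alpha> w j) = (\<Sum>j = 1..M - 1. u j * w j)
      + sigma2 \<alpha> * (\<Sum>j = 1..M - 1. u j * (w (j + 1) - 2 * w j + w (j - 1)))"
    unfolding Lop_def sum_distrib_left sum.distrib[symmetric]
    by (intro sum.cong refl) (simp add: algebra_simps)
  then show ?thesis
    unfolding sum_second_difference_by_parts[OF assms] by simp
qed

lemma energy_bounds:
  assumes \<alpha>: "1 < \<alpha>" "\<alpha> < 2" and w: "w 0 = 0" "w M = 0" "M > 0"
  shows "(1 - 4 * sigma2 \<alpha>) * (\<Sum>j = 1..M - 1. (w j)\<^sup>2) \<le> energy \<alpha> M w"
    and "energy \<alpha> M w \<le> (\<Sum>j = 1..M - 1. (w j)\<^sup>2)"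
  using mult_left_mono[OF sum_square_difference_le[OF w] sigma2_bounds(1)[OF \<alpha>]]
    sigma2_bounds(1)[OF \<alpha>]
  by (auto simp: energy_def algebra_simps intro!: mult_nonneg_nonneg sum_nonneg)

lemma Lop_diff: "Lop \<alpha> (\<lambda>i. u i - v i) j = Lop \<alpha> u j - Lop \<alpha> v j"
  by (simp add: Lop_def algebra_simps)

lemma delta_x_diff: "delta_x \<alpha> h M (\<lambda>i. u i - v i) j = delta_x \<alpha> h M u j - delta_x \<alpha> h M v j"
  unfolding delta_x_def right_diff_distrib sum_subtractf
  by (simp only: right_diff_distrib[symmetric] add_diff_add)

lemma delta_t_diff: "delta_t \<tau> (\<lambda>k j. u k j - v k j) k = (\<lambda>j. delta_t \<tau> u k j - delta_t \<tau> v k j)"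
  by (simp add: delta_t_def fun_eq_iff algebra_simps flip: diff_divide_distrib)

lemma mid_t_diff: "mid_t (\<lambda>k j. u k j - v k j) k = (\<lambda>j. mid_t u k j - mid_t v k j)"
  by (simp add: mid_t_def fun_eq_iff field_simps)

text \<open>As the form of \<open>Lop\<close> is symmetric, pairing the midpoint average with the difference quotient
  telescopes.\<close>

lemma energy_step:
  assumes "\<tau> > 0" "M > 0" "e k 0 = 0" "e k M = 0" "e (k + 1) 0 = 0" "e (k + 1) M = 0"
  shows "energy \<alpha> M (e (k + 1)) - energy \<alpha> M (e k)
       = 2 * \<tau> * (\<Sum>j = 1..M - 1. mid_t e k j * Lop \<alpha> (delta_t \<tau> e k) j)"
proof -
  have diff_squares: "2 * \<tau> * ((p + q) / 2 * ((p - q) / \<tau>)) = p\<^sup>2 - q\<^sup>2" for p q :: real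
    using assms by (simp add: field_simps power2_eq_square)
  have prod: "2 * \<tau> * (mid_t e k j * delta_t \<tau> e k j) = (e (k + 1) j)\<^sup>2 - (e k j)\<^sup>2" for j
    unfolding mid_t_def delta_t_def by (rule diff_squares)
  have prod': "2 * \<tau> * ((mid_t e k (j + 1) - mid_t e k j) * (delta_t \<tau> e k (j + 1) - delta_t \<tau> e k j))
      = (e (k + 1) (j + 1) - e (k + 1) j)\<^sup>2 - (e k (j + 1) - e k j)\<^sup>2" for j
  proof -
    have "delta_t \<tau> e k (j + 1) - delta_t \<tau> e k j
        = ((e (k + 1) (j + 1) - e (k + 1) j) - (e k (j + 1) - e k j)) / \<tau>"
      by (simp add: delta_t_def diff_divide_distrib)
    moreover have "mid_t e k (j + 1) - mid_t e k j
        = ((e (k + 1) (j + 1) - e (k + 1) j) + (e k (j + 1) - e k j)) / 2"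
      by (simp add: mid_t_def field_simps)
    ultimately show ?thesis
      by (simp only: diff_squares)
  qed
  have "2 * \<tau> * (\<Sum>j = 1..M - 1. mid_t e k j * Lop \<alpha> (delta_t \<tau> e k) j)
      = (\<Sum>j = 1..M - 1. 2 * \<tau> * (mid_t e k j * delta_t \<tau> e k j)) - sigma2 \<alpha> *
        (\<Sum>j<M. 2 * \<tau> * ((mid_t e k (j + 1) - mid_t e k j) * (delta_t \<tau> e k (j + 1) - delta_t \<tau> e k j)))"
  proof -
    have "mid_t e k 0 = 0" "mid_t e k M = 0"
      using assms by (simp_all add: mid_t_def)
    from sum_Lop_by_parts[OF this \<open>M > 0\<close>] show ?thesis
      by (simp only: right_diff_distrib sum_distrib_left mult.left_commute)
  qed
  also have "\<dots> = energy \<alpha> M (e (k + 1)) - energy \<alpha> M (e k)"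
    unfolding prod prod' energy_def by (simp add: sum_subtractf algebra_simps)
  finally show ?thesis ..
qed

section \<open>Stability\<close>

text \<open>The difference of two solutions with the same source solves the homogeneous scheme.\<close>

lemma solves_scheme_diff:
  assumes u: "solves_scheme \<alpha> K L T f M N a u" and v: "solves_scheme \<alpha> K L T f M N b v"
    and k: "k < N" and j: "j \<in> {1..M - 1}"
  defines "e \<equiv> \<lambda>k j. u k j - v k j"
  shows "Lop \<alpha> (delta_t (T / real N) e k) j
       = - Lop \<alpha> (mid_t e k) j + K * delta_x \<alpha> (L / real M) M (mid_t e k) j"
proof -
  have "Lop \<alpha> (delta_t (T / real N) w k) j
      = - Lop \<alpha> (mid_t w k) j + K * delta_x \<alpha> (L / real M) M (mid_t w k) j
        + Lop \<alpha> (\<lambda>i. f (real i * (L / real M)) ((real k + 1 / 2) * (T / real N))) j"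
    if "solves_scheme \<alpha> K L T f M N c w" for w c
    using that k j unfolding solves_scheme_def Let_def by auto
  from this[OF u] this[OF v] show ?thesis
    unfolding e_def delta_t_diff mid_t_diff Lop_diff delta_x_diff by (simp add: algebra_simps)
qed

lemma solves_scheme_boundary:
  assumes "solves_scheme \<alpha> K L T f M N a u" and "1 \<le> k" "k \<le> N"
  shows "u k 0 = 0" "u k M = 0"
  using assms unfolding solves_scheme_def Let_def by auto

lemma solves_scheme_initial:
  assumes "solves_scheme \<alpha> K L T f M N a u" and "j \<le> M"
  shows "u 0 j = a j"
  using assms unfolding solves_scheme_def Let_def by auto

lemma energy_antimono:
  assumes \<alpha>: "1 < \<alpha>" "\<alpha> < 2" and pos: "K > 0" "L > 0" "T > 0" "M > 0" "N > 0"
    and u: "solves_scheme \<alpha> K L T f M N a u" and v: "solves_scheme \<alpha> K L T f M N b v"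
    and ab: "a 0 = b 0" "a M = b M" and k: "k \<le> N"
  defines "e \<equiv> \<lambda>k j. u k j - v k j"
  shows "energy \<alpha> M (e k) \<le> energy \<alpha> M (e 0)"
  using k
proof (induction k)
  case (Suc k)
  define \<tau> where "\<tau> = T / real N"
  have \<tau>: "\<tau> > 0" using pos by (simp add: \<tau>_def)
  have bd: "e i 0 = 0" "e i M = 0" if "i \<le> N" for i
    using that solves_scheme_boundary[OF u, of i] solves_scheme_boundary[OF v, of i]
      solves_scheme_initial[OF u] solves_scheme_initial[OF v] ab
    by (cases "i = 0"; simp add: e_def)+
  define m where "m = mid_t e k"
  have m: "m 0 = 0" "m M = 0"
    using bd[of k] bd[of "k + 1"] Suc.prems by (simp_all add: m_def mid_t_def)
  have "(\<Sum>j = 1..M - 1. m j * Lop \<alpha> (delta_t \<tau> e k) j)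
      = (\<Sum>j = 1..M - 1. - (m j * Lop \<alpha> m j) + K * (m j * delta_x \<alpha> (L / real M) M m j))"
  proof (intro sum.cong refl)
    fix j assume "j \<in> {1..M - 1}"
    from solves_scheme_diff[OF u v _ this, of k] Suc.prems
    have "Lop \<alpha> (delta_t \<tau> e k) j = - Lop \<alpha> m j + K * delta_x \<alpha> (L / real M) M m j"
      by (simp add: \<tau>_def m_def e_def)
    then show "m j * Lop \<alpha> (delta_t \<tau> e k) j
        = - (m j * Lop \<alpha> m j) + K * (m j * delta_x \<alpha> (L / real M) M m j)"
      by (simp add: right_diff_distrib mult.left_commute)
  qed
  also have "\<dots> = - energy \<alpha> M m + K * (\<Sum>j = 1..M - 1. m j * delta_x \<alpha> (L / real M) M m j)"
    unfolding sum.distrib sum_negf sum_Lop_by_parts[OF m \<open>M > 0\<close>] energy_def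
    by (simp add: power2_eq_square sum_distrib_left)
  also have "\<dots> \<le> 0"
  proof -
    have "0 \<le> (1 - 4 * sigma2 \<alpha>) * (\<Sum>j = 1..M - 1. (m j)\<^sup>2)"
      using sigma2_bounds(2)[OF \<alpha>] by (intro mult_nonneg_nonneg sum_nonneg) auto
    then have "0 \<le> energy \<alpha> M m"
      using energy_bounds(1)[OF \<alpha> m \<open>M > 0\<close>] by linarith
    moreover have "K * (\<Sum>j = 1..M - 1. m j * delta_x \<alpha> (L / real M) M m j) \<le> 0"
      using sum_delta_x_nonpos[OF \<alpha> _ m, of "L / real M"] pos by (intro mult_nonneg_nonpos) auto
    ultimately show ?thesis by linarith
  qed
  finally have "2 * \<tau> * (\<Sum>j = 1..M - 1. m j * Lop \<alpha> (delta_t \<tau> e k) j) \<le> 0"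
    using \<tau> by (intro mult_nonneg_nonpos) auto
  then have "energy \<alpha> M (e (k + 1)) \<le> energy \<alpha> M (e k)"
    using energy_step[OF \<tau> \<open>M > 0\<close>, of e k \<alpha>] bd[of k] bd[of "k + 1"] Suc.prems by (simp add: m_def)
  then show ?case using Suc by simp
qed simp

theorem theorem4p5:
  fixes \<alpha> K L T :: real
    and f :: "real \<Rightarrow> real \<Rightarrow> real"
    and u0 :: "real \<Rightarrow> real"
  assumes "1 < \<alpha>" and "\<alpha> < 2" and "K > 0" and "L > 0" and "T > 0"
  shows "\<exists>C > 0. \<forall>M N u v \<epsilon>. M > 0 \<longrightarrow> N > 0 \<longrightarrow> \<epsilon> \<in> V_h M \<longrightarrow>
           solves_scheme \<alpha> K L T f M N (\<lambda>j. u0 (real j * (L / real M))) u \<longrightarrow>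
           solves_scheme \<alpha> K L T f M N (\<lambda>j. u0 (real j * (L / real M)) + \<epsilon> j) v \<longrightarrow>
           (\<forall>k \<le> N. norm_h (L / real M) M (\<lambda>j. u k j - v k j) \<le> C * norm_h (L / real M) M \<epsilon>)"
proof (intro exI[of _ "1 / sqrt (1 - 4 * sigma2 \<alpha>)"] conjI allI impI)
  note \<alpha> = \<open>1 < \<alpha>\<close> \<open>\<alpha> < 2\<close>
  let ?c = "1 - 4 * sigma2 \<alpha>"
  have c: "?c > 0" using sigma2_bounds(2)[OF \<alpha>] by simp
  then show "1 / sqrt ?c > 0" by simp
  fix M N :: nat and u v :: "nat \<Rightarrow> nat \<Rightarrow> real" and \<epsilon> :: "nat \<Rightarrow> real" and k :: nat
  assume "M > 0" "N > 0" and \<epsilon>: "\<epsilon> \<in> V_h M"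
    and u: "solves_scheme \<alpha> K L T f M N (\<lambda>j. u0 (real j * (L / real M))) u"
    and v: "solves_scheme \<alpha> K L T f M N (\<lambda>j. u0 (real j * (L / real M)) + \<epsilon> j) v"
    and k: "k \<le> N"
  define h where "h = L / real M"
  have h: "h > 0" using \<open>L > 0\<close> \<open>M > 0\<close> by (simp add: h_def)
  define e where "e = (\<lambda>k j. u k j - v k j)"
  have \<epsilon>0: "\<epsilon> 0 = 0" "\<epsilon> M = 0" using \<epsilon> by (auto simp: V_h_def)
  have e0: "e 0 j = - \<epsilon> j" if "j \<le> M" for j
    using solves_scheme_initial[OF u that] solves_scheme_initial[OF v that] by (simp add: e_def)
  have bd: "e k 0 = 0" "e k M = 0"
    using k e0 \<epsilon>0 solves_scheme_boundary[OF u, of k] solves_scheme_boundary[OF v, of k]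
    by (cases "k = 0"; simp add: e_def)+
  have "?c * (\<Sum>j = 1..M - 1. (e k j)\<^sup>2) \<le> energy \<alpha> M (e k)"
    by (rule energy_bounds(1)[OF \<alpha> bd \<open>M > 0\<close>])
  also have "\<dots> \<le> energy \<alpha> M (e 0)"
    using energy_antimono[OF \<alpha> \<open>K > 0\<close> \<open>L > 0\<close> \<open>T > 0\<close> \<open>M > 0\<close> \<open>N > 0\<close> u v _ _ k] \<epsilon>0
    by (simp add: e_def)
  also have "\<dots> \<le> (\<Sum>j = 1..M - 1. (e 0 j)\<^sup>2)"
    using e0 \<epsilon>0 \<open>M > 0\<close> by (intro energy_bounds(2)[OF \<alpha>]) simp_all
  also have "\<dots> = (\<Sum>j = 1..M - 1. (\<epsilon> j)\<^sup>2)"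
    by (intro sum.cong refl) (auto simp: e0)
  finally have "h * (?c * (\<Sum>j = 1..M - 1. (e k j)\<^sup>2)) \<le> h * (\<Sum>j = 1..M - 1. (\<epsilon> j)\<^sup>2)"
    using h by simp
  then have "?c * inner_h h M (e k) (e k) \<le> inner_h h M \<epsilon> \<epsilon>"
    unfolding inner_h_def power2_eq_square by (simp only: mult.left_commute)
  then have "sqrt ?c * norm_h h M (e k) \<le> norm_h h M \<epsilon>"
    unfolding norm_h_def real_sqrt_mult[symmetric] by (rule real_sqrt_le_mono)
  then have "norm_h h M (e k) \<le> 1 / sqrt ?c * norm_h h M \<epsilon>"
    using c by (simp add: field_simps)
  then show "norm_h (L / real M) M (\<lambda>j. u k j - v k j) \<le> 1 / sqrt ?c * norm_h (L / real M) M \<epsilon>"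
    by (simp only: h_def e_def)
qed

end
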